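(* Let $\lambda\ge1$, $n\ge2$, $s\ge1$ and $k>s$ be integers. Suppose that $n\nmid\lambda\binom{s+\ell-1}{\ell-1}$ for every $\ell\in\{1,\ldots,k-s\}$, and that $P^{(k,s,\lambda)}_{n;I}\neq\emptyset$. Then $$\dim\left(P^{(k,s,\lambda)}_{n;I}\right)=\dim\left(P^{(k,s,\lambda)}_{n}\right)=n^k-\sum_{j=0}^s\binom{k}{j}(n-1)^j.$$
   Context: Fix $n$ symbols $l_1,\ldots,l_n$. An orthogonal array $\mathrm{OA}(\lambda n^s,k,n,s)$ is a $\lambda n^s\times k$ array with entries in $\{l_1,\ldots,l_n\}$ such that in every choice of $s$ columns each of the $n^s$ symbol combinations appears as a row exactly $\lambda$ times. Its frequency vector $x\in\mathbb{Z}^{n^k}$, indexed by $\{l_1,\ldots,l_n\}^k$, counts how often each $(i_1,\ldots,i_k)$ appears as a row. Consider the system in $x\in\mathbb{R}^{n^k}$: for every $\{j_1,\ldots,j_s\}\subseteq\{1,\ldots,k\}$ and every $(i_{j_1},\ldots,i_{j_s})\in\{l_1,\ldots,l_n\}^s$, the sum of $x(i_1,\ldots,i_k)$ over all values of the remaining $k-s$ indices equals $\lambda$; and $0\le x(i_1,\ldots,i_k)\le p_{\max}$ for all $(i_1,\ldots,i_k)$. Here $p_{\max}\le\lambda$ is a fixed positive integer that is an upper bound for every entry of the frequency vector of every $\mathrm{OA}(\lambda n^s,k,n,s)$, so the integer solutions are exactly the frequency vectors of all $\mathrm{OA}(\lambda n^s,k,n,s)$. $P^{(k,s,\lambda)}_{n}$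 is the set of all real solutions of this system and $P^{(k,s,\lambda)}_{n;I}$ is the convex hull of its integer solutions. The dimension of a non-empty convex set is the dimension of its affine hull. *)

theory Defs
  imports "HOL-Analysis.Analysis"
begin

text \<open>
  The \<open>k\<close> columns are the elements of a finite type \<open>'k\<close> and the \<open>n\<close> symbols those of a
  finite type \<open>'n\<close>, so \<open>k = CARD('k)\<close> and \<open>n = CARD('n)\<close>. A \<open>k\<close>-tuple of symbols
  is a function \<^typ>\<open>'k \<Rightarrow> 'n\<close>; an array with \<open>k\<close> columns is the list of its rows.
  The space \<open>real ^ ('k \<Rightarrow> 'n)\<close> is Euclidean of dimension \<open>n ^ k\<close>.
\<close>

text \<open>
  A symbol combination on a set \<open>J\<close> of columns is represented by a total function
  \<open>\<sigma>\<close> of which only the values on \<open>J\<close> are used.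
\<close>

definition agree_on :: "'k set \<Rightarrow> ('k \<Rightarrow> 'n) \<Rightarrow> ('k \<Rightarrow> 'n) set"
  where "agree_on J \<sigma> = {i. \<forall>j\<in>J. i j = \<sigma> j}"

definition orthogonal_array :: "nat \<Rightarrow> nat \<Rightarrow> ('k::finite \<Rightarrow> 'n::finite) list \<Rightarrow> bool"
  where "orthogonal_array lam s A \<longleftrightarrow>
    length A = lam * CARD('n) ^ s \<and>
    (\<forall>J \<sigma>. card J = s \<longrightarrow> card {r. r < length A \<and> A ! r \<in> agree_on J \<sigma>} = lam)"

definition OA_polytope :: "nat \<Rightarrow> nat \<Rightarrow> nat \<Rightarrow> (real ^ ('k::finite \<Rightarrow> 'n::finite)) set"
  where "OA_polytope lam s p = {x.
    (\<forall>J \<sigma>. card J = s \<longrightarrow> (\<Sum>i\<in>agree_on J \<sigma>. x $ i) = real lam) \<and>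
    (\<forall>i. 0 \<le> x $ i \<and> x $ i \<le> real p)}"

definition OA_integer_polytope :: "nat \<Rightarrow> nat \<Rightarrow> nat \<Rightarrow> (real ^ ('k::finite \<Rightarrow> 'n::finite)) set"
  where "OA_integer_polytope lam s p =
    convex hull {x \<in> OA_polytope lam s p. \<forall>i. x $ i \<in> \<int>}"

text \<open>The entry of the frequency vector of \<open>A\<close> at \<open>i\<close> is \<open>count_list A i\<close>.\<close>

definition frequency_bound :: "('k::finite \<Rightarrow> 'n::finite) itself \<Rightarrow> nat \<Rightarrow> nat \<Rightarrow> nat \<Rightarrow> bool"
  where "frequency_bound _ lam s p \<longleftrightarrow>
    (\<forall>A :: ('k \<Rightarrow> 'n) list. orthogonal_array lam s A \<longrightarrow> (\<forall>i. count_list A i \<le> p))"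

lemma card_rows: "card {r. r < length A \<and> A ! r \<in> S} = (\<Sum>i\<in>S. count_list A i)" if "finite S"
proof -
  have "card {r. r < length A \<and> A ! r \<in> S} = length (filter (\<lambda>i. i \<in> S) A)"
    by (simp add: length_filter_conv_card)
  also have "\<dots> = (\<Sum>i\<in>S. count_list A i)"
    using that
  proof (induction A)
    case (Cons a A)
    have "(\<Sum>i\<in>S. count_list (a # A) i) = (\<Sum>i\<in>S. (if a = i then 1 else 0) + count_list A i)"
      by (rule sum.cong) auto
    also have "\<dots> = (if a \<in> S then 1 else 0) + (\<Sum>i\<in>S. count_list A i)"
      using Cons.prems by (simp add: sum.distrib sum.delta)
    finally show ?case using Cons by simp
  qed simp
  finally show ?thesis .
qed

lemma integer_points_eq_frequency_vectors:
  assumes "frequency_bound TYPE('k::finite \<Rightarrow> 'n::finite) lam s p" "s \<le> CARD('k)"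
  shows "{x \<in> OA_polytope lam s p. \<forall>i. x $ i \<in> \<int>} =
    {\<chi> i. real (count_list A i) |A :: ('k \<Rightarrow> 'n) list. orthogonal_array lam s A}"
proof (intro equalityI subsetI)
  fix x assume "x \<in> {\<chi> i. real (count_list A i) |A :: ('k \<Rightarrow> 'n) list. orthogonal_array lam s A}"
  then obtain A :: "('k \<Rightarrow> 'n) list" where A: "orthogonal_array lam s A"
     "x = (\<chi> i. real (count_list A i))" by auto
  have "(\<Sum>i\<in>agree_on J \<sigma>. count_list A i) = lam" if "card J = s" for J \<sigma>
    using A(1) that unfolding orthogonal_array_def card_rows[OF finite, symmetric] by blast
  then show "x \<in> {x \<in> OA_polytope lam s p. \<forall>i. x $ i \<in> \<int>}"
    using A assms(1) by (auto simp: OA_polytope_def frequency_bound_def simp flip: of_nat_sum)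
next
  fix x :: "real ^ ('k \<Rightarrow> 'n)" assume x: "x \<in> {x \<in> OA_polytope lam s p. \<forall>i. x $ i \<in> \<int>}"
  define f where "f i = nat \<lfloor>x $ i\<rfloor>" for i
  have f: "x $ i = real (f i)" for i
  proof -
    have "x $ i \<in> \<int>" "0 \<le> x $ i" using x by (auto simp: OA_polytope_def)
    then show ?thesis by (auto simp: f_def elim!: Ints_cases)
  qed
  obtain A where A: "mset A = (\<Sum>i\<in>UNIV. replicate_mset (f i) i)" using ex_mset by blast
  have c: "count_list A i = f i" for i
  proof -
    have "count (mset A) i = (\<Sum>j\<in>UNIV. if j = i then f j else 0)"
      unfolding A by (auto simp: count_sum intro!: sum.cong)
    then show ?thesis by (simp add: count_mset)
  qed
  have L: "(\<Sum>i\<in>agree_on J \<sigma>. count_list A i) = lam" if "card J = s" for J \<sigma>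
  proof -
    have "(\<Sum>i\<in>agree_on J \<sigma>. x $ i) = real lam" using x that by (auto simp: OA_polytope_def)
    then have "real (\<Sum>i\<in>agree_on J \<sigma>. f i) = real lam" by (simp add: f)
    then show ?thesis by (simp only: c of_nat_eq_iff)
  qed
  obtain J :: "'k set" where J: "card J = s" using obtain_subset_with_card_n[OF assms(2)] by blast
  define R where "R = J \<rightarrow>\<^sub>E (UNIV :: 'n set)"
  have "length A = (\<Sum>i\<in>UNIV. count_list A i)"
    using card_rows[of UNIV A] by simp
  also have "\<dots> = (\<Sum>\<sigma>\<in>R. \<Sum>i\<in>{i\<in>UNIV. restrict i J = \<sigma>}. count_list A i)"
    by (rule sum.group[symmetric]) (auto simp: R_def)
  also have "\<dots> = (\<Sum>\<sigma>\<in>R. lam)"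
  proof (rule sum.cong[OF refl])
    fix \<sigma> assume s: "\<sigma> \<in> R"
    have "{i\<in>UNIV. restrict i J = \<sigma>} = agree_on J \<sigma>"
      using s by (force simp: R_def agree_on_def PiE_def extensional_def restrict_def)
    then show "(\<Sum>i\<in>{i\<in>UNIV. restrict i J = \<sigma>}. count_list A i) = lam" using L[OF J] by simp
  qed
  also have "\<dots> = lam * CARD('n) ^ s" by (simp add: R_def card_PiE J)
  finally have "orthogonal_array lam s A"
    unfolding orthogonal_array_def card_rows[OF finite] using L by blast
  moreover have "x = (\<chi> i. real (count_list A i))" by (simp add: vec_eq_iff c f)
  ultimately show "x \<in> {\<chi> i. real (count_list A i) |A :: ('k \<Rightarrow> 'n) list. orthogonal_array lam s A}" by blast
qed

end

theory Submission
  imports Defs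
begin

text \<open>
  Write \<open>\<delta>\<^sub>c\<close> for the indicator of a symbol \<open>c\<close> and fix a base symbol \<open>z\<close>. The space of functions on
  \<open>k\<close>-tuples is a tensor product over the columns. For a tuple \<open>u\<close> let \<open>T\<close> be the set of columns in which
  \<open>u\<close> differs from \<open>z\<close>, and attach to \<open>u\<close> two product functions: the cylinder, with factor
  \<open>\<delta>\<^bsub>u t\<^esub>\<close> for \<open>t \<in> T\<close> and constant factor \<open>1\<close> elsewhere, and the contrast, with factor
  \<open>\<delta>\<^bsub>u t\<^esub> - \<delta>\<^sub>z\<close> for \<open>t \<in> T\<close> and \<open>1\<close> elsewhere. The pairing of cylinders with
  contrasts is triangular with respect to \<open>card T\<close>, so each of the two families is linearly independent.
  The claimed dimension is the number of tuples \<open>u\<close> with \<open>card T > s\<close>.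

  Upper bound: the defining equations fix the marginals on \<open>s\<close> columns, hence those on fewer columns.
  So differences of points of the polytope are orthogonal to all cylinders with \<open>card T \<le> s\<close>.

  Lower bound: every contrast with \<open>card T > s\<close> is a linear combination of differences of integer points.
  Indeed, permuting the symbols of each column separately preserves the integer points. Taking in the columns
  of \<open>T\<close> the identity minus a transposition, and averaging over all permutations elsewhere, is an operator of
  rank one: it sends \<open>x\<close> to a positive multiple of \<open>\<langle>x, b\<rangle> b\<close>, where \<open>b\<close> is the contrast
  that belongs to the transpositions (\<open>signed_sum_relabel\<close>). Since its coefficients add up to \<open>0\<close>, the result
  is a combination of differences. It remains to find an integer point that is not orthogonal to the contrast.

  This is where divisibility enters (\<open>exists_contrast_not_orthogonal\<close>). If an integer point were orthogonal to
  the contrasts on \<open>T\<close> with fixed first symbols \<open>a\<close> and arbitrary second symbols, then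
  summing these relations would give \<open>(\<Sum>U\<subseteq>T. (-1)^|U| n^|U| M(U)) = 0\<close>, where \<open>M(U)\<close> is
  the marginal on \<open>U\<close> at \<open>a\<close>. For \<open>|U| \<le> s\<close> the term is \<open>(-1)^|U| \<lambda> n^s\<close>; for larger \<open>U\<close> it is
  divisible by \<open>n^(s+1)\<close> because \<open>M(U)\<close> is an integer. As the signs of the small subsets add up to
  \<open>(-1)^s\<close> times the binomial coefficient \<open>|T| - 1\<close> over \<open>s\<close>, the number \<open>n\<close> would divide \<open>\<lambda>\<close> times
  that coefficient, which for \<open>|T| = s + l\<close> is the excluded case.
\<close>

section \<open>Cylinders and contrasts\<close>

text \<open>
  The indicator of \<^const>\<open>agree_on\<close> (see \<open>inner_cylinder\<close>), as a product with one factor for every column,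
  so that sums over tuples factor into sums over symbols.
\<close>
definition cylinder :: "'k::finite set \<Rightarrow> ('k \<Rightarrow> 'n::finite) \<Rightarrow> real ^ ('k \<Rightarrow> 'n)"
  where "cylinder J \<sigma> = (\<chi> m. \<Prod>t\<in>UNIV. if t \<in> J then of_bool (m t = \<sigma> t) else 1)"

definition contrast ::
    "'k::finite set \<Rightarrow> ('k \<Rightarrow> 'n::finite) \<Rightarrow> ('k \<Rightarrow> 'n) \<Rightarrow> real ^ ('k \<Rightarrow> 'n)"
  where "contrast T a b =
    (\<chi> m. \<Prod>t\<in>UNIV. if t \<in> T then of_bool (m t = a t) - of_bool (m t = b t) else 1)"

lemma sum_prod_columns:
  fixes F :: "'k::finite \<Rightarrow> 'n::finite \<Rightarrow> 'a::comm_semiring_1"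
  shows "(\<Sum>m\<in>UNIV. \<Prod>t\<in>UNIV. F t (m t)) = (\<Prod>t\<in>UNIV. \<Sum>c\<in>UNIV. F t c)"
  by (subst prod_sum_PiE) auto

lemma inner_cylinder: "cylinder J \<sigma> \<bullet> x = (\<Sum>m\<in>agree_on J \<sigma>. x $ m)"
proof -
  have "cylinder J \<sigma> $ m = of_bool (m \<in> agree_on J \<sigma>)" for m
  proof (cases "m \<in> agree_on J \<sigma>")
    case True
    then have "(\<Prod>t\<in>UNIV. if t \<in> J then of_bool (m t = \<sigma> t) else 1 :: real) = (\<Prod>t\<in>UNIV. 1)"
      by (auto simp: agree_on_def intro!: prod.neutral)
    with True show ?thesis by (simp add: cylinder_def)
  next
    case False
    then obtain t where "t \<in> J" "m t \<noteq> \<sigma> t" by (auto simp: agree_on_def)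
    then have "(\<Prod>t\<in>UNIV. if t \<in> J then of_bool (m t = \<sigma> t) else 1 :: real) = 0"
      by (intro prod_zero) auto
    with False show ?thesis by (simp add: cylinder_def)
  qed
  then show ?thesis
    by (simp add: inner_vec_def of_bool_def if_distrib[of "\<lambda>c. c * _"] sum.If_cases cong: if_cong)
qed

text \<open>
  Each factor is the pairing of two functions of one symbol. The factor vanishes for \<open>t \<in> T - J\<close> since a
  contrast sums to zero in every column of \<open>T\<close>.
\<close>

lemma inner_cylinder_contrast:
  "cylinder J \<sigma> \<bullet> contrast T a b = (\<Prod>t\<in>UNIV.
     if t \<in> T then if t \<in> J then of_bool (\<sigma> t = a t) - of_bool (\<sigma> t = b t) else 0
     else if t \<in> J then 1 else real CARD('n))"
  for \<sigma> :: "'k::finite \<Rightarrow> 'n::finite"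
proof -
  have "cylinder J \<sigma> \<bullet> contrast T a b = (\<Sum>m\<in>UNIV. \<Prod>t\<in>UNIV.
      (if t \<in> J then of_bool (m t = \<sigma> t) else 1) *
      (if t \<in> T then of_bool (m t = a t) - of_bool (m t = b t) else 1))"
    by (simp add: inner_vec_def cylinder_def contrast_def prod.distrib)
  also have "\<dots> = (\<Prod>t\<in>UNIV. \<Sum>c\<in>UNIV.
      (if t \<in> J then of_bool (c = \<sigma> t) else 1) *
      (if t \<in> T then of_bool (c = a t) - of_bool (c = b t) else 1))"
    by (rule sum_prod_columns)
  also have "\<dots> = (\<Prod>t\<in>UNIV.
     if t \<in> T then if t \<in> J then of_bool (\<sigma> t = a t) - of_bool (\<sigma> t = b t) else 0
     else if t \<in> J then 1 else real CARD('n))"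
    by (intro prod.cong refl) (simp add: of_bool_def sum_subtractf if_distrib[of "\<lambda>c. c * _"] cong: if_cong)
  finally show ?thesis .
qed

definition columns_off :: "'n \<Rightarrow> ('k \<Rightarrow> 'n) \<Rightarrow> 'k set"
  where "columns_off z u = {t. u t \<noteq> z}"

lemma inner_cylinder_contrast_same:
  "cylinder (columns_off z u) u \<bullet> contrast (columns_off z u) u (\<lambda>_. z) \<noteq> 0"
  for u :: "'k::finite \<Rightarrow> 'n::finite"
  unfolding inner_cylinder_contrast by (auto simp: columns_off_def)

text \<open>
  A nonzero pairing forces \<open>v\<close> to agree with \<open>u\<close> wherever \<open>u\<close> is off the base symbol. If \<open>v\<close> is another
  tuple, it must therefore be off the base symbol in some further column.
\<close>

lemma inner_cylinder_contrast_distinct: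
  fixes u v :: "'k::finite \<Rightarrow> 'n::finite"
  assumes "cylinder (columns_off z v) v \<bullet> contrast (columns_off z u) u (\<lambda>_. z) \<noteq> 0" "u \<noteq> v"
  shows "card (columns_off z u) < card (columns_off z v)"
proof -
  have *: "u t \<noteq> z \<Longrightarrow> v t = u t" for t
  proof -
    have "(if t \<in> columns_off z u then if t \<in> columns_off z v
        then of_bool (v t = u t) - of_bool (v t = z) else 0
      else if t \<in> columns_off z v then 1 else real CARD('n)) \<noteq> 0"
      using assms(1) unfolding inner_cylinder_contrast by simp
    then show "u t \<noteq> z \<Longrightarrow> v t = u t" by (auto simp: columns_off_def split: if_splits)
  qed
  obtain t where "u t \<noteq> v t" using assms(2) by auto
  with * have "t \<in> columns_off z v - columns_off z u" by (force simp: columns_off_def)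
  moreover have "columns_off z u \<subseteq> columns_off z v" using * by (force simp: columns_off_def)
  ultimately show ?thesis by (intro psubset_card_mono) auto
qed

text \<open>
  In a nontrivial linear relation among the \<open>w v\<close>, pair with \<open>g v\<close> for an index \<open>v\<close> of maximal rank among
  those that occur: only the diagonal term survives.
\<close>

lemma dim_triangular_family:
  fixes w g :: "'i \<Rightarrow> 'v::euclidean_space" and rank :: "'i \<Rightarrow> int"
  assumes "finite S"
    and diag: "\<And>u. u \<in> S \<Longrightarrow> g u \<bullet> w u \<noteq> 0"
    and off: "\<And>u v. \<lbrakk>u \<in> S; v \<in> S; u \<noteq> v; g u \<bullet> w v \<noteq> 0\<rbrakk> \<Longrightarrow> rank u < rank v"
  shows "dim (w ` S) = card S"
proof -
  have zero: "c u = 0" if "(\<Sum>v\<in>S. c v *\<^sub>R w v) = 0" "u \<in> S" for c u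
  proof (rule ccontr)
    assume "c u \<noteq> 0"
    define B where "B = {v \<in> S. c v \<noteq> 0}"
    have "finite (rank ` B)" "rank ` B \<noteq> {}" using \<open>finite S\<close> that(2) \<open>c u \<noteq> 0\<close> by (auto simp: B_def)
    then have "Max (rank ` B) \<in> rank ` B" "\<And>v. v \<in> B \<Longrightarrow> rank v \<le> Max (rank ` B)" by auto
    then obtain v where v: "v \<in> B" "\<And>v'. v' \<in> B \<Longrightarrow> rank v' \<le> rank v" by auto
    have "0 = g v \<bullet> (\<Sum>v'\<in>S. c v' *\<^sub>R w v')" using that by simp
    also have "\<dots> = (\<Sum>v'\<in>S. c v' * (g v \<bullet> w v'))" by (simp add: inner_sum_right)
    also have "\<dots> = (\<Sum>v'\<in>{v}. c v' * (g v \<bullet> w v'))"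
      using \<open>finite S\<close> v off by (intro sum.mono_neutral_right) (force simp: B_def)+
    finally show False using v diag by (auto simp: B_def)
  qed
  have inj: "inj_on w S"
  proof (rule inj_onI, rule ccontr)
    fix u v assume uv: "u \<in> S" "v \<in> S" "w u = w v" "u \<noteq> v"
    have "(\<Sum>x\<in>S. (of_bool (x = u) - of_bool (x = v)) *\<^sub>R w x) = w u - w v"
      using uv \<open>finite S\<close>
      by (simp add: scaleR_left_diff_distrib sum_subtractf of_bool_def
          if_distrib[of "\<lambda>c. c *\<^sub>R _"] cong: if_cong)
    then show False using zero[of "\<lambda>x. of_bool (x = u) - of_bool (x = v)" u] uv by simp
  qed
  have "independent (w ` S)"
  proof (rule independent_if_scalars_zero)
    fix f x assume "(\<Sum>y\<in>w ` S. f y *\<^sub>R y) = 0" "x \<in> w ` S"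
    then show "f x = 0" using zero[of "f \<circ> w"] inj by (auto simp: sum.reindex)
  qed (use \<open>finite S\<close> in simp)
  then show ?thesis using inj by (simp add: dim_eq_card_independent card_image)
qed

lemma dim_cylinders:
  fixes S :: "('k::finite \<Rightarrow> 'n::finite) set"
  shows "dim ((\<lambda>u. cylinder (columns_off z u) u) ` S) = card S"
  by (rule dim_triangular_family[where g = "\<lambda>u. contrast (columns_off z u) u (\<lambda>_. z)"
        and rank = "\<lambda>u. int (card (columns_off z u))"])
    (auto simp: inner_cylinder_contrast_same inner_commute intro: inner_cylinder_contrast_distinct)

lemma dim_contrasts:
  fixes S :: "('k::finite \<Rightarrow> 'n::finite) set"
  shows "dim ((\<lambda>u. contrast (columns_off z u) u (\<lambda>_. z)) ` S) = card S"
  by (rule dim_triangular_family[where g = "\<lambda>u. cylinder (columns_off z u) u"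
        and rank = "\<lambda>u. - int (card (columns_off z u))"])
    (auto simp: inner_cylinder_contrast_same intro: inner_cylinder_contrast_distinct)

text \<open>
  A tuple is determined by its set of columns off \<open>z\<close> and a symbol other than \<open>z\<close> in each of these.
\<close>

lemma card_columns_off_le:
  "int (card {u :: 'k::finite \<Rightarrow> 'n::finite. card (columns_off z u) \<le> s}) =
    (\<Sum>j=0..s. int (CARD('k) choose j) * (int CARD('n) - 1) ^ j)"
proof -
  have exact: "card {u :: 'k \<Rightarrow> 'n. columns_off z u = T} = (CARD('n) - 1) ^ card T" for T
  proof -
    have "bij_betw (\<lambda>u. restrict u T) {u. columns_off z u = T} (T \<rightarrow>\<^sub>E (UNIV - {z}))"
      by (rule bij_betwI[where g = "\<lambda>f t. if t \<in> T then f t else z"])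
        (auto simp: columns_off_def PiE_def extensional_def fun_eq_iff split: if_splits)
    then show ?thesis by (simp add: bij_betw_same_card card_PiE)
  qed
  have "{u :: 'k \<Rightarrow> 'n. card (columns_off z u) \<le> s} =
      (\<Union>T\<in>{T. card T \<le> s}. {u. columns_off z u = T})" by auto
  then have "card {u :: 'k \<Rightarrow> 'n. card (columns_off z u) \<le> s} =
      (\<Sum>T\<in>{T :: 'k set. card T \<le> s}. (CARD('n) - 1) ^ card T)"
    by (simp only:, subst card_UN_disjoint) (auto simp: exact)
  also have "\<dots> = (\<Sum>j\<in>{0..s}. \<Sum>T\<in>{T \<in> {T :: 'k set. card T \<le> s}. card T = j}. (CARD('n) - 1) ^ card T)"
    by (rule sum.group[symmetric]) auto
  also have "\<dots> = (\<Sum>j=0..s. (CARD('k) choose j) * (CARD('n) - 1) ^ j)"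
  proof (rule sum.cong)
    fix j assume "j \<in> {0..s}"
    then have "{T \<in> {T :: 'k set. card T \<le> s}. card T = j} = {T. T \<subseteq> UNIV \<and> card T = j}" by auto
    then show "(\<Sum>T\<in>{T \<in> {T :: 'k set. card T \<le> s}. card T = j}. (CARD('n) - 1) ^ card T) =
        (CARD('k) choose j) * (CARD('n) - 1) ^ j"
      by (simp add: n_subsets[of "UNIV :: 'k set", simplified])
  qed simp
  finally show ?thesis
    by (simp add: of_nat_diff Suc_leI)
qed

section \<open>Relabelling symbols\<close>

definition relabel :: "('k \<Rightarrow> 'n \<Rightarrow> 'n) \<Rightarrow> real ^ ('k::finite \<Rightarrow> 'n::finite) \<Rightarrow> real ^ ('k \<Rightarrow> 'n)"
  where "relabel \<pi> x = (\<chi> m. x $ (\<lambda>t. \<pi> t (m t)))"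

lemma sum_relabel:
  fixes x :: "real ^ ('k::finite \<Rightarrow> 'n::finite)"
  assumes "\<And>t. bij (\<pi> t)"
  shows "(\<Sum>m\<in>agree_on J \<sigma>. relabel \<pi> x $ m) = (\<Sum>m\<in>agree_on J (\<lambda>t. \<pi> t (\<sigma> t)). x $ m)"
proof (rule sum.reindex_bij_witness[where i = "\<lambda>m t. inv (\<pi> t) (m t)" and j = "\<lambda>m t. \<pi> t (m t)"])
  show "(\<lambda>t. inv (\<pi> t) (m t)) \<in> agree_on J \<sigma>" if "m \<in> agree_on J (\<lambda>t. \<pi> t (\<sigma> t))" for m
    using that assms by (auto simp: agree_on_def bij_is_inj)
qed (use assms in \<open>auto simp: agree_on_def relabel_def bij_is_inj bij_is_surj surj_f_inv_f\<close>)

text \<open>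
  The number of permutations with a prescribed value is the same for every argument and value, so the sum of
  all permutation matrices is a multiple of the all-ones matrix.
\<close>

lemma card_bij_value:
  fixes i m z :: "'n::finite"
  shows "card {h :: 'n \<Rightarrow> 'n. bij h \<and> h i = m} = card {h :: 'n \<Rightarrow> 'n. bij h \<and> h z = z}"
proof (rule bij_betw_same_card[OF bij_betwI])
  let ?f = "\<lambda>h :: 'n \<Rightarrow> 'n. Transposition.transpose m z \<circ> h \<circ> Transposition.transpose i z"
  show "?f \<in> {h. bij h \<and> h i = m} \<rightarrow> {h. bij h \<and> h z = z}"
    by (auto intro!: bij_comp)
  show "?f \<in> {h. bij h \<and> h z = z} \<rightarrow> {h. bij h \<and> h i = m}"
    by (auto intro!: bij_comp)
qed (auto simp: fun_eq_iff)

text \<open>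
  The operator is a tensor product of operators in the columns. In a column of \<open>T\<close> it is the identity matrix
  minus the matrix of the transposition of \<open>a t\<close> and \<open>b t\<close>, which is the rank-one matrix with entries
  \<open>\<beta> t i * \<beta> t m\<close> for \<open>\<beta> t = \<delta>\<^bsub>a t\<^esub> - \<delta>\<^bsub>b t\<^esub>\<close>; in any other column it is the sum of all
  permutation matrices.
\<close>

lemma signed_sum_relabel:
  fixes x :: "real ^ ('k::finite \<Rightarrow> 'n::finite)" and a b :: "'k \<Rightarrow> 'n" and T :: "'k set"
  defines "w \<equiv> \<lambda>t h. if t \<in> T
    then of_bool (h = id) - of_bool (h = Transposition.transpose (a t) (b t)) else (1 :: real)"
  obtains K :: real where "K > 0"
    "(\<Sum>\<pi>\<in>{\<pi>. \<forall>t. bij (\<pi> t)}. (\<Prod>t\<in>UNIV. w t (\<pi> t)) *\<^sub>R relabel \<pi> x) =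
      (K * (contrast T a b \<bullet> x)) *\<^sub>R contrast T a b"
proof -
  define H where "H = {h :: 'n \<Rightarrow> 'n. bij h}"
  define c where "c = real (card {h :: 'n \<Rightarrow> 'n. bij h \<and> h undefined = undefined})"
  have "id \<in> {h :: 'n \<Rightarrow> 'n. bij h \<and> h undefined = undefined}" by simp
  then have "{h :: 'n \<Rightarrow> 'n. bij h \<and> h undefined = undefined} \<noteq> {}" by blast
  then have "c > 0" by (simp add: c_def card_gt_0_iff)
  have G: "{\<pi>. \<forall>t. bij (\<pi> t)} = PiE (UNIV :: 'k set) (\<lambda>_. H)" by (auto simp: H_def)
  define \<beta> where "\<beta> t m = of_bool (m = a t) - (of_bool (m = b t) :: real)" for t m
  have column: "(\<Sum>h\<in>H. w t h * of_bool (h i = m)) = (if t \<in> T then \<beta> t i * \<beta> t m else c)" for t i m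
  proof (cases "t \<in> T")
    case True
    let ?\<tau> = "Transposition.transpose (a t) (b t)"
    have pick: "(\<Sum>h\<in>H. of_bool (h = g) * of_bool (h i = m)) = (of_bool (g i = m) :: real)"
      if "g \<in> H" for g
      using that by (simp add: of_bool_def if_distrib[of "\<lambda>c. c * _"] cong: if_cong)
    have "(\<Sum>h\<in>H. w t h * of_bool (h i = m)) = of_bool (id i = m) - of_bool (?\<tau> i = m)"
      using True pick[of id] pick[of ?\<tau>] by (simp add: w_def left_diff_distrib sum_subtractf H_def)
    also have "\<dots> = \<beta> t i * \<beta> t m"
      by (auto simp: \<beta>_def Transposition.transpose_def of_bool_def)
    finally show ?thesis using True by simp
  next
    case False
    have "(\<Sum>h\<in>H. of_bool (h i = m)) = real (card {h. bij h \<and> h i = m})"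
      by (simp add: H_def of_bool_def sum.If_cases Int_def)
    with False show ?thesis by (simp add: w_def c_def card_bij_value[of i m undefined])
  qed
  have "(\<Sum>\<pi>\<in>{\<pi>. \<forall>t. bij (\<pi> t)}. (\<Prod>t\<in>UNIV. w t (\<pi> t)) *\<^sub>R relabel \<pi> x) $ i =
      ((c ^ card (- T) * (contrast T a b \<bullet> x)) *\<^sub>R contrast T a b) $ i" for i
  proof -
    have delta: "x $ g = (\<Sum>m\<in>UNIV. x $ m * (\<Prod>t\<in>UNIV. of_bool (g t = m t)))" for g
    proof -
      have "(\<Prod>t\<in>UNIV. of_bool (g t = m t)) = (of_bool (g = m) :: real)" for m
        by (auto simp: fun_eq_iff)
      then show ?thesis by (simp add: of_bool_def if_distrib[of "\<lambda>c. _ * c"] cong: if_cong)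
    qed
    have split: "(\<Prod>t\<in>UNIV. if t \<in> T then \<beta> t (i t) * \<beta> t (m t) else c) =
        c ^ card (- T) * (contrast T a b $ i * contrast T a b $ m)" for m
      by (simp add: contrast_def prod.If_cases \<beta>_def prod.distrib Compl_eq_Diff_UNIV set_diff_eq Int_def)
    have "(\<Sum>\<pi>\<in>{\<pi>. \<forall>t. bij (\<pi> t)}. (\<Prod>t\<in>UNIV. w t (\<pi> t)) *\<^sub>R relabel \<pi> x) $ i =
        (\<Sum>\<pi>\<in>PiE UNIV (\<lambda>_. H). (\<Prod>t\<in>UNIV. w t (\<pi> t)) *
          (\<Sum>m\<in>UNIV. x $ m * (\<Prod>t\<in>UNIV. of_bool (\<pi> t (i t) = m t))))"
      by (simp add: G relabel_def flip: delta)
    also have "\<dots> = (\<Sum>m\<in>UNIV. x $ m *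
        (\<Sum>\<pi>\<in>PiE UNIV (\<lambda>_. H). \<Prod>t\<in>UNIV. w t (\<pi> t) * of_bool (\<pi> t (i t) = m t)))"
      unfolding sum_distrib_left by (subst sum.swap) (simp add: prod.distrib ac_simps)
    also have "\<dots> = (\<Sum>m\<in>UNIV. x $ m * (\<Prod>t\<in>UNIV. \<Sum>h\<in>H. w t h * of_bool (h (i t) = m t)))"
      by (subst prod_sum_PiE) auto
    also have "\<dots> = c ^ card (- T) * (contrast T a b \<bullet> x) * contrast T a b $ i"
      by (simp add: column split inner_vec_def sum_distrib_left sum_distrib_right ac_simps)
    finally show ?thesis by simp
  qed
  then show thesis
    using that[of "c ^ card (- T)"] \<open>c > 0\<close> by (simp add: vec_eq_iff)
qed

text \<open>
  The signs in a column of \<open>T\<close> add up to zero, hence so do the coefficients of the signed sum of relabellings.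
  Replacing every \<open>relabel \<pi> x\<close> by \<open>relabel \<pi> x - x\<close> does not change it, so it lies in \<open>V\<close>.
\<close>

lemma contrast_in_subspace:
  fixes x :: "real ^ ('k::finite \<Rightarrow> 'n::finite)"
  assumes V: "subspace V" and rel: "\<And>\<pi>. (\<And>t. bij (\<pi> t)) \<Longrightarrow> relabel \<pi> x - x \<in> V"
    and "T \<noteq> {}" and nz: "contrast T a b \<bullet> x \<noteq> 0"
  shows "contrast T a b \<in> V"
proof -
  define w where "w \<equiv> \<lambda>t h. if t \<in> T
    then of_bool (h = id) - of_bool (h = Transposition.transpose (a t) (b t)) else (1 :: real)"
  let ?G = "{\<pi> :: 'k \<Rightarrow> 'n \<Rightarrow> 'n. \<forall>t. bij (\<pi> t)}"
  obtain K where K: "K > 0" "(\<Sum>\<pi>\<in>?G. (\<Prod>t\<in>UNIV. w t (\<pi> t)) *\<^sub>R relabel \<pi> x) =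
      (K * (contrast T a b \<bullet> x)) *\<^sub>R contrast T a b"
    unfolding w_def by (rule signed_sum_relabel)
  have "(\<Sum>\<pi>\<in>?G. \<Prod>t\<in>UNIV. w t (\<pi> t)) = 0"
  proof -
    have "?G = PiE UNIV (\<lambda>_. {h. bij h})" by auto
    then have "(\<Sum>\<pi>\<in>?G. \<Prod>t\<in>UNIV. w t (\<pi> t)) = (\<Prod>t\<in>UNIV. \<Sum>h\<in>{h. bij h}. w t h)"
      by (subst prod_sum_PiE) auto
    also obtain t where t: "t \<in> T" using \<open>T \<noteq> {}\<close> by auto
    then have "(\<Sum>h\<in>{h. bij h}. w t h) = 0"
      by (simp add: w_def sum_subtractf of_bool_def)
    then have "(\<Prod>t\<in>UNIV. \<Sum>h\<in>{h. bij h}. w t h) = 0" by (intro prod_zero) auto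
    finally show ?thesis .
  qed
  then have "(\<Sum>\<pi>\<in>?G. (\<Prod>t\<in>UNIV. w t (\<pi> t)) *\<^sub>R relabel \<pi> x) =
      (\<Sum>\<pi>\<in>?G. (\<Prod>t\<in>UNIV. w t (\<pi> t)) *\<^sub>R (relabel \<pi> x - x))"
    by (simp add: scaleR_right_diff_distrib sum_subtractf flip: scaleR_left.sum)
  also have "\<dots> \<in> V"
    using V rel by (intro subspace_sum subspace_scale) auto
  finally have "(K * (contrast T a b \<bullet> x)) *\<^sub>R contrast T a b \<in> V"
    unfolding K .
  moreover have "K * (contrast T a b \<bullet> x) \<noteq> 0" using K(1) nz by simp
  ultimately show ?thesis
    using subspace_scale[OF V, of _ "inverse (K * (contrast T a b \<bullet> x))"]
    by (metis left_inverse scaleR_one scaleR_scaleR)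
qed

text \<open>
  Turns an integer point that detects an arbitrary contrast with first symbols \<open>a\<close> into one that
  detects the contrast with second symbol \<open>z\<close>: interchanging \<open>z\<close> and \<open>b t\<close> leaves \<open>a t\<close> fixed.
\<close>

lemma inner_contrast_relabel:
  fixes x :: "real ^ ('k::finite \<Rightarrow> 'n::finite)"
  assumes "\<And>t. t \<in> T \<Longrightarrow> a t \<noteq> z" "\<And>t. t \<in> T \<Longrightarrow> a t \<noteq> b t"
  shows "contrast T a (\<lambda>_. z) \<bullet> relabel (\<lambda>t. Transposition.transpose z (b t)) x = contrast T a b \<bullet> x"
proof -
  let ?\<rho> = "\<lambda>m t. Transposition.transpose z (b t) (m t)"
  have "contrast T a b $ (?\<rho> m) = contrast T a (\<lambda>_. z) $ m" for m
    unfolding contrast_def vec_lambda_beta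
    by (intro prod.cong) (auto simp: Transposition.transpose_def dest: assms)
  then show ?thesis
    unfolding inner_vec_def
    by (intro sum.reindex_bij_witness[where i = ?\<rho> and j = ?\<rho>]) (auto simp: relabel_def)
qed

section \<open>The divisibility obstruction\<close>

text \<open>
  Splitting according to the symbol in a further column \<open>t\<close> writes a marginal on \<open>U\<close> as a sum of \<open>n\<close> marginals
  on \<open>insert t U\<close>.
\<close>

lemma marginal_of_smaller_set:
  fixes x :: "real ^ ('k::finite \<Rightarrow> 'n::finite)"
  assumes s: "s \<le> CARD('k)"
    and eq: "\<And>J \<sigma>. card J = s \<Longrightarrow> (\<Sum>i\<in>agree_on J \<sigma>. x $ i) = real lam"
    and "card U \<le> s"
  shows "(\<Sum>i\<in>agree_on U \<sigma>. x $ i) = real (lam * CARD('n) ^ (s - card U))"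
  using \<open>card U \<le> s\<close>
proof (induction "s - card U" arbitrary: U \<sigma>)
  case 0
  then show ?case using eq by simp
next
  case (Suc d)
  then have "card U < CARD('k)" using s by linarith
  then have "U \<noteq> UNIV" by auto
  then obtain t where t: "t \<notin> U" by auto
  have "(\<Sum>i\<in>agree_on U \<sigma>. x $ i) = (\<Sum>c\<in>UNIV. \<Sum>i\<in>{i \<in> agree_on U \<sigma>. i t = c}. x $ i)"
    by (rule sum.group[symmetric]) auto
  also have "\<dots> = (\<Sum>c\<in>UNIV. \<Sum>i\<in>agree_on (insert t U) (\<sigma>(t := c)). x $ i)"
    using t by (intro sum.cong refl) (auto simp: agree_on_def)
  also have "\<dots> = (\<Sum>c\<in>(UNIV :: 'n set). real (lam * CARD('n) ^ d))"
  proof (rule sum.cong[OF refl])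
    fix c
    have "d = s - card (insert t U)" "card (insert t U) \<le> s" using Suc t by auto
    then show "(\<Sum>i\<in>agree_on (insert t U) (\<sigma>(t := c)). x $ i) = real (lam * CARD('n) ^ d)"
      using Suc.hyps(1)[of "insert t U" "\<sigma>(t := c)"] by simp
  qed
  also have "\<dots> = real (lam * CARD('n) ^ (s - card U))" by (simp flip: Suc.hyps(2))
  finally show ?case .
qed

lemma alternating_sum_small_subsets:
  assumes "finite T" "T \<noteq> {}"
  shows "(\<Sum>U | U \<subseteq> T \<and> card U \<le> s. (- 1 :: int) ^ card U) = (- 1) ^ s * int ((card T - 1) choose s)"
proof -
  have fin: "finite {U. U \<subseteq> T \<and> card U \<le> s}" using \<open>finite T\<close> by simp
  have "(\<Sum>U | U \<subseteq> T \<and> card U \<le> s. (- 1 :: int) ^ card U) =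
      (\<Sum>j\<le>s. \<Sum>U\<in>{U \<in> {U. U \<subseteq> T \<and> card U \<le> s}. card U = j}. (- 1) ^ card U)"
    by (rule sum.group[symmetric]) (use fin in auto)
  also have "\<dots> = (\<Sum>j\<le>s. int (card T choose j) * (- 1) ^ j)"
  proof (rule sum.cong[OF refl])
    fix j assume "j \<in> {..s}"
    then have "{U \<in> {U. U \<subseteq> T \<and> card U \<le> s}. card U = j} = {U. U \<subseteq> T \<and> card U = j}" by auto
    then show "(\<Sum>U\<in>{U \<in> {U. U \<subseteq> T \<and> card U \<le> s}. card U = j}. (- 1) ^ card U) =
        int (card T choose j) * (- 1) ^ j"
      by (simp add: n_subsets[OF \<open>finite T\<close>])
  qed
  also have "real_of_int \<dots> = (\<Sum>j\<le>s. (real (card T) gchoose j) * (- 1) ^ j)"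
    by (simp add: binomial_gbinomial)
  also have "\<dots> = (- 1) ^ s * (real (card T) - 1 gchoose s)" by (rule gbinomial_sum_lower_neg)
  also have "real (card T) - 1 = real (card T - 1)"
    using assms by (simp add: of_nat_diff Suc_leI card_gt_0_iff)
  finally have "real_of_int (\<Sum>U | U \<subseteq> T \<and> card U \<le> s. (- 1 :: int) ^ card U) =
      real_of_int ((- 1) ^ s * int ((card T - 1) choose s))"
    by (simp add: binomial_gbinomial)
  then show ?thesis by (simp only: of_int_eq_iff)
qed

text \<open>
  Summing \<open>\<delta>\<^bsub>a t\<^esub> - \<delta>\<^bsub>b t\<^esub>\<close> over the symbol \<open>b t\<close> gives \<open>n \<delta>\<^bsub>a t\<^esub> - 1\<close>; the subsets
  \<open>U\<close> come from multiplying out the product of these over \<open>T\<close>. The second symbols range over the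
  extensional functions on \<open>T\<close>, because the contrast depends only on their values there.
\<close>

lemma sum_inner_contrast:
  fixes x :: "real ^ ('k::finite \<Rightarrow> 'n::finite)"
  shows "(\<Sum>b\<in>T \<rightarrow>\<^sub>E UNIV. contrast T a b \<bullet> x) =
    (- 1) ^ card T * (\<Sum>U\<in>Pow T. (- 1) ^ card U * real CARD('n) ^ card U * (\<Sum>i\<in>agree_on U a. x $ i))"
proof -
  have column_product: "contrast T a b $ m = (\<Prod>t\<in>T. of_bool (m t = a t) - of_bool (m t = b t))" for b m
    by (simp add: contrast_def prod.If_cases)
  have all: "(\<Prod>t\<in>U. of_bool (m t = a t)) = (of_bool (m \<in> agree_on U a) :: real)" for U m
    by (auto simp: agree_on_def of_bool_def intro: prod.neutral)
  have "(\<Sum>b\<in>T \<rightarrow>\<^sub>E UNIV. contrast T a b $ m) =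
      (- 1) ^ card T * (\<Sum>U\<in>Pow T. (- 1) ^ card U * real CARD('n) ^ card U * of_bool (m \<in> agree_on U a))" for m
  proof -
    have "(\<Sum>b\<in>T \<rightarrow>\<^sub>E UNIV. contrast T a b $ m) =
        (\<Prod>t\<in>T. \<Sum>c\<in>UNIV. of_bool (m t = a t) - of_bool (m t = c))"
      unfolding column_product by (subst prod_sum_PiE) auto
    also have "\<dots> = (\<Prod>t\<in>T. real CARD('n) * of_bool (m t = a t) + - 1)"
      by (intro prod.cong) (auto simp: sum_subtractf of_bool_def)
    also have "\<dots> = (\<Sum>U\<in>Pow T. real CARD('n) ^ card U * of_bool (m \<in> agree_on U a) * (- 1) ^ card (T - U))"
      by (subst prod_add) (simp_all add: prod.distrib all)
    also have "\<dots> = (\<Sum>U\<in>Pow T. (- 1) ^ card T * ((- 1) ^ card U * real CARD('n) ^ card U * of_bool (m \<in> agree_on U a)))"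
    proof (rule sum.cong[OF refl])
      fix U assume "U \<in> Pow T"
      then have "card T = card U + card (T - U)"
        by (simp add: card_Diff_subset card_mono finite_subset)
      then have "(- 1 :: real) ^ card (T - U) = (- 1) ^ card T * (- 1) ^ card U"
        by (simp add: power_add flip: power_mult_distrib)
      then show "real CARD('n) ^ card U * of_bool (m \<in> agree_on U a) * (- 1) ^ card (T - U) =
          (- 1) ^ card T * ((- 1) ^ card U * real CARD('n) ^ card U * of_bool (m \<in> agree_on U a))"
        by simp
    qed
    finally show ?thesis by (simp only: sum_distrib_left)
  qed
  note pointwise = this
  have marg: "(\<Sum>i\<in>agree_on U a. x $ i) = (\<Sum>m\<in>UNIV. of_bool (m \<in> agree_on U a) * x $ m)" for U
    by (simp add: of_bool_def if_distrib[of "\<lambda>c. c * _"] sum.If_cases cong: if_cong)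
  have "(\<Sum>b\<in>T \<rightarrow>\<^sub>E UNIV. contrast T a b \<bullet> x) =
      (\<Sum>m\<in>UNIV. (\<Sum>b\<in>T \<rightarrow>\<^sub>E UNIV. contrast T a b $ m) * x $ m)"
    by (simp add: inner_vec_def sum_distrib_right) (rule sum.swap)
  also have "\<dots> = (- 1) ^ card T * (\<Sum>U\<in>Pow T. (- 1) ^ card U * real CARD('n) ^ card U * (\<Sum>i\<in>agree_on U a. x $ i))"
    unfolding pointwise marg sum_distrib_left sum_distrib_right mult.assoc by (rule sum.swap)
  finally show ?thesis .
qed

text \<open>
  Otherwise the signed sum of marginals in \<open>sum_inner_contrast\<close> is zero. All its terms are divisible by \<open>n ^ s\<close>;
  after division by it, the sets with more than \<open>s\<close> columns contribute multiples of \<open>n\<close>, and those with at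
  most \<open>s\<close> columns contribute \<open>lam\<close> times an alternating sum that is a binomial coefficient up to sign.
\<close>

lemma exists_contrast_not_orthogonal:
  fixes x :: "real ^ ('k::finite \<Rightarrow> 'n::finite)"
  assumes int: "\<And>i. x $ i \<in> \<int>"
    and marg: "\<And>U. card U \<le> s \<Longrightarrow> (\<Sum>i\<in>agree_on U a. x $ i) = real (lam * CARD('n) ^ (s - card U))"
    and T: "s < card T" and ndvd: "\<not> CARD('n) dvd lam * ((card T - 1) choose s)"
  shows "\<exists>b. contrast T a b \<bullet> x \<noteq> 0"
proof (rule ccontr)
  assume no: "\<not> ?thesis"
  define n where "n = int CARD('n)"
  have "n > 0" by (simp add: n_def)
  \<comment> \<open>Rounding down only moves the integer marginals to the type \<^typ>\<open>int\<close>, where divisibility makes sense.\<close>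
  define M where "M U = \<lfloor>\<Sum>i\<in>agree_on U a. x $ i\<rfloor>" for U
  have M: "(\<Sum>i\<in>agree_on U a. x $ i) = of_int (M U)" for U
  proof -
    have "(\<Sum>i\<in>agree_on U a. x $ i) \<in> \<int>" using int by (intro Ints_sum)
    then show ?thesis unfolding M_def by (elim Ints_cases) simp
  qed
  let ?small = "{U. U \<subseteq> T \<and> card U \<le> s}" and ?large = "{U. U \<subseteq> T \<and> s < card U}"
  have "(\<Sum>U\<in>Pow T. (- 1) ^ card U * real CARD('n) ^ card U * (\<Sum>i\<in>agree_on U a. x $ i)) = 0"
    using no sum_inner_contrast[of T a x] by simp
  then have "real_of_int (\<Sum>U\<in>Pow T. (- 1) ^ card U * n ^ card U * M U) = 0"
    by (simp add: M n_def)
  then have "0 = (\<Sum>U\<in>Pow T. (- 1) ^ card U * n ^ card U * M U)" by (simp only: of_int_eq_0_iff)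
  also have "Pow T = ?small \<union> ?large" by auto
  also have "(\<Sum>U\<in>?small \<union> ?large. (- 1) ^ card U * n ^ card U * M U) =
      (\<Sum>U\<in>?small. (- 1) ^ card U * n ^ card U * M U) + (\<Sum>U\<in>?large. (- 1) ^ card U * n ^ card U * M U)"
    by (rule sum.union_disjoint) auto
  also have "(\<Sum>U\<in>?small. (- 1) ^ card U * n ^ card U * M U) = (\<Sum>U\<in>?small. n ^ s * int lam * (- 1) ^ card U)"
  proof (rule sum.cong[OF refl])
    fix U assume U: "U \<in> ?small"
    then have "real_of_int (M U) = of_int (int lam * n ^ (s - card U))"
      using marg[of U] by (simp add: n_def flip: M)
    then have "M U = int lam * n ^ (s - card U)" by (simp only: of_int_eq_iff)
    moreover have "n ^ s = n ^ card U * n ^ (s - card U)" using U by (simp flip: power_add)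
    ultimately show "(- 1) ^ card U * n ^ card U * M U = n ^ s * int lam * (- 1) ^ card U" by simp
  qed
  also have "\<dots> = n ^ s * (int lam * ((- 1) ^ s * int ((card T - 1) choose s)))"
    using alternating_sum_small_subsets[of T s] T by (force simp flip: sum_distrib_left)
  also have "(\<Sum>U\<in>?large. (- 1) ^ card U * n ^ card U * M U) =
      (\<Sum>U\<in>?large. n ^ s * (n * ((- 1) ^ card U * n ^ (card U - Suc s) * M U)))"
  proof (rule sum.cong[OF refl])
    fix U assume "U \<in> ?large"
    then have "n ^ card U = n ^ s * (n * n ^ (card U - Suc s))"
      by (simp flip: power_add power_Suc)
    then show "(- 1) ^ card U * n ^ card U * M U = n ^ s * (n * ((- 1) ^ card U * n ^ (card U - Suc s) * M U))"
      by simp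
  qed
  finally have "n ^ s * (int lam * ((- 1) ^ s * int ((card T - 1) choose s)) +
      n * (\<Sum>U\<in>?large. (- 1) ^ card U * n ^ (card U - Suc s) * M U)) = 0"
    by (simp add: sum_distrib_left distrib_left)
  then have "(- 1) ^ s * (int lam * int ((card T - 1) choose s)) =
      n * - (\<Sum>U\<in>?large. (- 1) ^ card U * n ^ (card U - Suc s) * M U)"
    using \<open>n > 0\<close> by (simp add: ac_simps)
  then have "n dvd (- 1) ^ s * (int lam * int ((card T - 1) choose s))" by (rule dvdI)
  then have "n dvd int (lam * ((card T - 1) choose s))"
    by (cases "even s") auto
  then show False using ndvd unfolding n_def int_dvd_int_iff by blast
qed

section \<open>The dimension\<close>

lemma OA_integer_point_relabel:
  assumes "x \<in> {x \<in> OA_polytope lam s p. \<forall>i. x $ i \<in> \<int>}" "\<And>t. bij (\<pi> t)"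
  shows "relabel \<pi> x \<in> {x \<in> OA_polytope lam s p. \<forall>i. x $ i \<in> \<int>}"
  using assms by (auto simp: OA_polytope_def sum_relabel) (auto simp: relabel_def)

text \<open>
  The point \<open>x\<close> itself is not orthogonal to some contrast with first symbols \<open>a\<close>; a relabelling \<open>y\<close> of it is then
  not orthogonal to the contrast with second symbol \<open>z\<close>, and the differences between \<open>y\<close> and its own
  relabellings produce that contrast.
\<close>

lemma contrast_in_direction_space:
  fixes x :: "real ^ ('k::finite \<Rightarrow> 'n::finite)" and lam s p :: nat
  defines "Z \<equiv> {x :: real ^ ('k \<Rightarrow> 'n). x \<in> OA_polytope lam s p \<and> (\<forall>i. x $ i \<in> \<int>)}"
  assumes x: "x \<in> Z" and s: "s < CARD('k)"
    and T: "s < card T" and ndvd: "\<not> CARD('n) dvd lam * ((card T - 1) choose s)"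
    and a: "\<And>t. t \<in> T \<Longrightarrow> a t \<noteq> z"
  shows "contrast T a (\<lambda>_. z) \<in> span ((\<lambda>y. y - x) ` Z)"
proof -
  have marg: "(\<Sum>i\<in>agree_on U \<sigma>. x $ i) = real (lam * CARD('n) ^ (s - card U))" if "card U \<le> s" for U \<sigma>
    using x s that by (intro marginal_of_smaller_set) (auto simp: Z_def OA_polytope_def)
  obtain b where b: "contrast T a b \<bullet> x \<noteq> 0"
    using exists_contrast_not_orthogonal[OF _ marg T ndvd] x by (auto simp: Z_def)
  have ab: "a t \<noteq> b t" if "t \<in> T" for t
  proof
    assume "a t = b t"
    then have "(\<Prod>t\<in>UNIV. if t \<in> T then of_bool (m t = a t) - of_bool (m t = b t) else 1 :: real) = 0" for m
      using that by (intro prod_zero bexI[of _ t]) auto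
    then have "contrast T a b = 0" by (simp add: contrast_def vec_eq_iff)
    with b show False by simp
  qed
  define y where "y = relabel (\<lambda>t. Transposition.transpose z (b t)) x"
  have invariant: "relabel \<pi> v \<in> Z" if "v \<in> Z" "\<And>t. bij (\<pi> t)" for \<pi> v
    using that unfolding Z_def by (rule OA_integer_point_relabel)
  have y: "y \<in> Z" unfolding y_def using x by (rule invariant) simp
  show ?thesis
  proof (rule contrast_in_subspace)
    show "contrast T a (\<lambda>_. z) \<bullet> y \<noteq> 0"
      unfolding y_def using a ab b by (subst inner_contrast_relabel) auto
    show "T \<noteq> {}" using T by auto
    show "subspace (span ((\<lambda>y. y - x) ` Z))" by simp
    fix \<pi> :: "'k \<Rightarrow> 'n \<Rightarrow> 'n" assume "\<And>t. bij (\<pi> t)"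
    then have "relabel \<pi> y \<in> Z" using invariant[OF y] by blast
    then have "(relabel \<pi> y - x) - (y - x) \<in> span ((\<lambda>y. y - x) ` Z)"
      using y by (intro span_diff[OF span_base span_base] imageI)
    then show "relabel \<pi> y - y \<in> span ((\<lambda>y. y - x) ` Z)" by simp
  qed
qed

theorem corollary2:
  fixes lam s p :: nat
  assumes "1 \<le> lam" and "2 \<le> CARD('n::finite)" and "1 \<le> s" and "s < CARD('k::finite)"
    and "1 \<le> p" and "p \<le> lam" and "frequency_bound TYPE('k \<Rightarrow> 'n) lam s p"
    and "\<forall>l\<in>{1..CARD('k) - s}. \<not> CARD('n) dvd lam * ((s + l - 1) choose (l - 1))"
    and "(OA_integer_polytope lam s p :: (real ^ ('k \<Rightarrow> 'n)) set) \<noteq> {}"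
  shows "aff_dim (OA_integer_polytope lam s p :: (real ^ ('k \<Rightarrow> 'n)) set)
           = aff_dim (OA_polytope lam s p :: (real ^ ('k \<Rightarrow> 'n)) set) \<and>
         aff_dim (OA_polytope lam s p :: (real ^ ('k \<Rightarrow> 'n)) set)
           = int (CARD('n) ^ CARD('k))
             - (\<Sum>j=0..s. int (CARD('k) choose j) * (int CARD('n) - 1) ^ j)"
proof -
  define P where "P = (OA_polytope lam s p :: (real ^ ('k \<Rightarrow> 'n)) set)"
  define Z where "Z = {x \<in> P. \<forall>i. x $ i \<in> \<int>}"
  have hull: "OA_integer_polytope lam s p = convex hull Z"
    unfolding Z_def P_def by (rule OA_integer_polytope_def)
  then obtain x where x: "x \<in> Z"
    using assms(9) by (metis convex_hull_empty ex_in_conv)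
  then have xP: "x \<in> P" by (simp add: Z_def)
  define z :: 'n where "z = undefined"
  define A where "A = {u :: 'k \<Rightarrow> 'n. card (columns_off z u) \<le> s}"
  define C where "C = (\<lambda>u. cylinder (columns_off z u) u) ` A"
  have total: "card A + card (- A) = CARD('n) ^ CARD('k)"
    using card_Un_disjoint[of A "- A"] by (simp add: card_fun)

  have "aff_dim P = int (dim ((\<lambda>y. y - x) ` P))"
    using xP by (intro aff_dim_eq_dim_subtract hull_inc)
  also have "\<dots> \<le> int (card (- A))"
  proof -
    have "(\<lambda>y. y - x) ` P \<subseteq> {d \<in> UNIV. \<forall>c\<in>span C. orthogonal c d}"
    proof clarsimp
      fix y c assume y: "y \<in> P" and c: "c \<in> span C"
      have "(y - x) \<bullet> c' = 0" if c': "c' \<in> C" for c'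
      proof -
        obtain u where u: "c' = cylinder (columns_off z u) u" "card (columns_off z u) \<le> s"
          using c' unfolding C_def A_def by blast
        have "(\<Sum>i\<in>agree_on (columns_off z u) u. v $ i) =
            real (lam * CARD('n) ^ (s - card (columns_off z u)))" if "v \<in> P" for v
          using that u(2) assms(4) by (intro marginal_of_smaller_set) (auto simp: P_def OA_polytope_def)
        then show ?thesis
          using xP y by (simp add: u(1) inner_commute[of "y - x"] inner_diff_right inner_cylinder)
      qed
      then show "orthogonal c (y - x)"
        using orthogonal_to_span[OF c, of "y - x"] by (simp add: orthogonal_def inner_commute)
    qed
    then have "dim ((\<lambda>y. y - x) ` P) \<le> dim {d \<in> UNIV. \<forall>c\<in>span C. orthogonal c d}"
      by (rule dim_subset)
    moreover have "dim {d \<in> UNIV. \<forall>c\<in>span C. orthogonal c d} + dim (span C) =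
        dim (UNIV :: (real ^ ('k \<Rightarrow> 'n)) set)"
      by (rule dim_subspace_orthogonal_to_vectors) auto
    moreover have "dim (span C) = card A" by (simp add: C_def dim_cylinders)
    moreover have "dim (UNIV :: (real ^ ('k \<Rightarrow> 'n)) set) = CARD('n) ^ CARD('k)"
      by (simp add: card_fun)
    ultimately show ?thesis using total by linarith
  qed
  finally have upper: "aff_dim P \<le> int (card (- A))" .

  have "(\<lambda>u. contrast (columns_off z u) u (\<lambda>_. z)) ` (- A) \<subseteq> span ((\<lambda>y. y - x) ` Z)"
  proof (rule image_subsetI)
    fix u assume "u \<in> - A"
    then have large: "s < card (columns_off z u)" by (simp add: A_def)
    define l where "l = card (columns_off z u) - s"
    have "card (columns_off z u) \<le> CARD('k)" by (simp add: card_mono)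
    then have l: "l \<in> {1..CARD('k) - s}" using large by (auto simp: l_def)
    have "s + l = card (columns_off z u)" using large by (simp add: l_def)
    moreover have "(s + l - 1) choose (l - 1) = (s + l - 1) choose s"
      using l binomial_symmetric[of s "s + l - 1"] by auto
    ultimately have "\<not> CARD('n) dvd lam * ((card (columns_off z u) - 1) choose s)"
      using assms(8) l by metis
    then show "contrast (columns_off z u) u (\<lambda>_. z) \<in> span ((\<lambda>y. y - x) ` Z)"
      unfolding Z_def P_def using x assms(4) large
      by (intro contrast_in_direction_space) (auto simp: Z_def P_def columns_off_def)
  qed
  then have "card (- A) \<le> dim (span ((\<lambda>y. y - x) ` Z))"
    unfolding dim_contrasts[of z "- A", symmetric] by (rule dim_subset)
  then have lower: "int (card (- A)) \<le> aff_dim Z"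
    using aff_dim_eq_dim_subtract[OF hull_inc[OF x]] by simp

  have "aff_dim Z \<le> aff_dim P" by (intro aff_dim_subset) (auto simp: Z_def)
  moreover have "aff_dim (OA_integer_polytope lam s p :: (real ^ ('k \<Rightarrow> 'n)) set) = aff_dim Z"
    by (simp only: hull aff_dim_convex_hull)
  moreover have "int (card A) = (\<Sum>j=0..s. int (CARD('k) choose j) * (int CARD('n) - 1) ^ j)"
    unfolding A_def by (rule card_columns_off_le)
  moreover have "int (card A) + int (card (- A)) = int (CARD('n) ^ CARD('k))"
    using total by (simp flip: of_nat_add)
  ultimately show ?thesis
    using upper lower unfolding P_def by linarith
qed

end
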